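(* Let $d(x),g(x)\in\mathbb{Z}[x]$ be non-zero polynomials with $\gcd(d(x),g(x))=1$ and $\deg(g)<\deg(d)$, and let $(\mathcal{F}_n(x))_{n\ge 0}$ be the Fibonacci-type polynomial sequence determined by $d(x)$ and $g(x)$. Let $p>2$ be a prime number and let $\Gamma=\{\gamma_1,\dots,\gamma_{p-1}\}\subset\mathbb{C}$ be the set of roots of the classical Fibonacci polynomial $F_p(x)$. Then $\mathcal{F}_p(x)$ is irreducible over $\mathbb{Q}$ if and only if $d(x)^2-g(x)\gamma^2$ is irreducible over $\mathbb{Q}(\gamma^2)$ for some $\gamma\in\Gamma$.
   Context: The Fibonacci-type polynomial sequence determined by $d(x),g(x)$ is defined by $\mathcal{F}_0(x)=0$, $\mathcal{F}_1(x)=1$, and $\mathcal{F}_n(x)=d(x)\mathcal{F}_{n-1}(x)+g(x)\mathcal{F}_{n-2}(x)$ for $n\ge 2$. Here $\gcd(d(x),g(x))=1$ means that the only common divisors of $d$ and $g$ in $\mathbb{Z}[x]$ are $\pm1$. The classical Fibonacci polynomials are defined by $F_0(x)=0$, $F_1(x)=1$, $F_n(x)=xF_{n-1}(x)+F_{n-2}(x)$ for $n\ge 2$. *)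

theory Defs
  imports
    "HOL-Algebra.Algebraic_Closure_Type"
    "HOL-Algebra.Generated_Fields"
    "HOL-Computational_Algebra.Computational_Algebra"
begin

fun fibonacci_type :: "int poly \<Rightarrow> int poly \<Rightarrow> nat \<Rightarrow> int poly" where
  "fibonacci_type d g 0 = 0"
| "fibonacci_type d g (Suc 0) = 1"
| "fibonacci_type d g (Suc (Suc n)) =
     d * fibonacci_type d g (Suc n) + g * fibonacci_type d g n"

definition fibonacci_poly :: "nat \<Rightarrow> int poly" where
  "fibonacci_poly = fibonacci_type [:0, 1:] 1"

lemma fibonacci_poly_simps [simp]:
  "fibonacci_poly 0 = 0"
  "fibonacci_poly (Suc 0) = 1"
  "fibonacci_poly (Suc (Suc n)) = [:0, 1:] * fibonacci_poly (Suc n) + fibonacci_poly n"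
  by (simp_all add: fibonacci_poly_def)

(* The subfield generated by a contains the prime field, so this is \<rat>(a). *)
definition rat_adjoin :: "complex \<Rightarrow> complex set" where
  "rat_adjoin a = generate_field ring_of_type_algebra {a}"

(* K[x], as a subring of the ring of all complex polynomials. *)
definition poly_ring_over :: "complex set \<Rightarrow> complex poly ring" where
  "poly_ring_over K = ring_of_type_algebra\<lparr>carrier := {f. \<forall>i. poly.coeff f i \<in> K}\<rparr>"

(* ring_irreducible does not itself require f to lie in the carrier. *)
definition irreducible_over :: "complex set \<Rightarrow> complex poly \<Rightarrow> bool" where
  "irreducible_over K f \<longleftrightarrow>
     f \<in> carrier (poly_ring_over K) \<and> ring_irreducible\<^bsub>poly_ring_over K\<^esub> f"

end

theory Submission
  imports Defs
begin

text \<open>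
  Write \<open>p = 2k + 1\<close>. Over the complex numbers, the Fibonacci-type polynomial of index \<open>p\<close> is
  the product of the \<open>k\<close> conjugate polynomials \<open>d\<^sup>2 - \<gamma>\<^sup>2 g\<close>, where \<open>\<gamma>\<^sup>2\<close> has degree \<open>k\<close> over
  the rationals: \<open>F\<^sub>p(x) = H(x\<^sup>2 + 4)\<close> for a polynomial \<open>H\<close> satisfying Eisenstein's criterion at \<open>p\<close>.

  Let \<open>x\<close> be a root of \<open>d\<^sup>2 - \<gamma>\<^sup>2 g\<close>. If this polynomial is irreducible over \<open>\<rat>(\<gamma>\<^sup>2)\<close>, it divides
  every rational polynomial vanishing at \<open>x\<close>; then so do its conjugates, and since these are
  pairwise coprime, the degree is at least that of the Fibonacci-type polynomial. If conversely \<open>x\<close>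
  is a root of a proper factor of degree \<open>a < 2 deg d\<close> over \<open>\<rat>(\<gamma>\<^sup>2)\<close>, all powers of \<open>x\<close> lie in a
  rational space of dimension at most \<open>k a\<close>, so \<open>x\<close> is a root of a nonzero rational polynomial
  of smaller degree than the Fibonacci-type polynomial.
\<close>

section \<open>Coefficient homomorphisms acting on polynomials\<close>

locale coeff_hom =
  fixes h :: "'a::comm_ring_1 \<Rightarrow> 'b::comm_ring_1"
  assumes hom_one: "h 1 = 1"
    and hom_add: "h (a + b) = h a + h b"
    and hom_mult: "h (a * b) = h a * h b"
begin

lemma hom_zero: "h 0 = 0"
  using hom_add[of 0 0] by simp

lemma hom_uminus: "h (- a) = - h a"
  using hom_add[of a "- a"] by (simp add: hom_zero add_eq_0_iff)

lemma hom_diff: "h (a - b) = h a - h b"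
  using hom_add[of a "- b"] by (simp add: hom_uminus)

lemma hom_sum: "h (\<Sum>i\<in>I. f i) = (\<Sum>i\<in>I. h (f i))"
  by (induction I rule: infinite_finite_induct) (simp_all add: hom_zero hom_add)

lemma map_poly_hom_add: "map_poly h (p + q) = map_poly h p + map_poly h q"
  by (rule poly_eqI) (simp add: coeff_map_poly hom_zero hom_add)

lemma map_poly_hom_diff: "map_poly h (p - q) = map_poly h p - map_poly h q"
  by (rule poly_eqI) (simp add: coeff_map_poly hom_zero hom_diff)

lemma map_poly_hom_mult: "map_poly h (p * q) = map_poly h p * map_poly h q"
  by (rule poly_eqI) (simp add: coeff_map_poly hom_zero coeff_mult hom_sum hom_mult)

lemma map_poly_hom_one: "map_poly h 1 = 1"
  by (simp add: hom_one)

lemma map_poly_hom_power: "map_poly h (p ^ n) = map_poly h p ^ n"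
  by (induction n) (simp_all add: map_poly_hom_mult hom_one)

lemma map_poly_hom_smult: "map_poly h (smult c p) = smult (h c) (map_poly h p)"
  by (rule poly_eqI) (simp add: coeff_map_poly hom_zero hom_mult)

lemmas map_poly_hom = map_poly_hom_add map_poly_hom_diff map_poly_hom_mult
  map_poly_hom_one map_poly_hom_power map_poly_hom_smult

end

interpretation int_hom: coeff_hom "of_int :: int \<Rightarrow> 'a::comm_ring_1"
  by standard simp_all

interpretation rat_hom: coeff_hom "of_rat :: rat \<Rightarrow> complex"
  by standard (simp_all add: of_rat_add of_rat_mult)

text \<open>As a coefficient homomorphism, evaluation lets \<open>map_poly (rat_eval z)\<close>
  specialise a polynomial with coefficients in \<rat>[t] at t = z. Its range is the ring
  \<rat>[z].\<close>

definition rat_eval :: "complex \<Rightarrow> rat poly \<Rightarrow> complex" where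
  "rat_eval z r = poly (map_poly of_rat r) z"

interpretation rat_eval_hom: coeff_hom "rat_eval z"
  by standard (simp_all add: rat_eval_def rat_hom.map_poly_hom)

lemma rat_eval_of_int: "rat_eval z (map_poly of_int q) = poly (map_poly of_int q) z"
  by (simp add: rat_eval_def map_poly_map_poly o_def)

section \<open>Gauss's lemma over the rationals\<close>

lemma clear_denominators:
  "\<exists>c (q :: int poly). c \<noteq> 0 \<and> smult (of_int c) (r :: rat poly) = map_poly of_int q"
proof (induction r)
  case 0
  show ?case by (rule exI[of _ 1], rule exI[of _ 0]) simp
next
  case (pCons a r)
  then obtain c q where c: "c \<noteq> 0" "smult (of_int c) r = map_poly of_int (q :: int poly)"
    by blast
  obtain u v where uv: "quotient_of a = (u, v)" by fastforce
  then have v: "v > 0" "a = of_int u / of_int v"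
    using quotient_of_denom_pos quotient_of_div by blast+
  have "smult (of_int (v * c)) (pCons a r) = map_poly of_int (pCons (c * u) (smult v q))"
    using v c by (simp add: map_poly_pCons int_hom.map_poly_hom flip: c(2))
  with v c show ?case
    by (intro exI[of _ "v * c"] exI[of _ "pCons (c * u) (smult v q)"]) auto
qed

lemma primitive_multiple:
  assumes "(r :: rat poly) \<noteq> 0"
  shows "\<exists>c (q :: int poly). c \<noteq> 0 \<and> content q = 1 \<and> r = smult c (map_poly of_int q)"
proof -
  obtain a q where q: "a \<noteq> 0" "smult (of_int a) r = map_poly of_int (q :: int poly)"
    using clear_denominators by blast
  have "q \<noteq> 0" using q assms by auto
  have "map_poly of_int q = smult (of_int (content q)) (map_poly of_int (primitive_part q) :: rat poly)"
    by (metis content_times_primitive_part int_hom.map_poly_hom_smult)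
  then have "r = smult (of_int (content q) / of_int a) (map_poly of_int (primitive_part q))"
    using q by (metis (no_types, lifting) divide_inverse_commute left_inverse of_int_eq_0_iff
      smult_1_left smult_smult)
  then show ?thesis
    using \<open>q \<noteq> 0\<close> q(1)
    by (intro exI[of _ "of_int (content q) / of_int a"] exI[of _ "primitive_part q"]) simp
qed

lemma map_poly_of_int_eq_iff:
  "map_poly of_int p = (map_poly of_int q :: 'a::{comm_ring_1,ring_char_0} poly) \<longleftrightarrow> p = q"
  by (auto simp: poly_eq_iff coeff_map_poly)

lemma degree_map_poly_of_int:
  "Polynomial.degree (map_poly of_int p :: 'a::{comm_ring_1,ring_char_0} poly) = Polynomial.degree p"
  by (rule degree_map_poly) simp

text \<open>Gauss's lemma: clearing denominators gives \<open>smult c q = p * s\<close>; contents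
  are multiplicative, so \<open>c\<close> divides the content of \<open>s\<close> and
  cancels.\<close>

lemma primitive_dvd_if_rat_dvd:
  assumes "content p = 1"
    and "map_poly of_int p dvd (map_poly of_int q :: rat poly)"
  shows "p dvd q"
proof -
  obtain r where r: "map_poly of_int q = (map_poly of_int p :: rat poly) * r"
    using assms(2) by blast
  obtain c s where s: "c \<noteq> 0" "smult (of_int c) r = map_poly of_int (s :: int poly)"
    using clear_denominators by blast
  have "map_poly of_int (smult c q) = (map_poly of_int (p * s) :: rat poly)"
    by (simp add: int_hom.map_poly_hom r flip: s(2))
  then have eq: "smult c q = p * s"
    by (simp only: map_poly_of_int_eq_iff)
  then have "content (smult c q) = content s"
    using assms(1) by (simp add: content_mult)
  then have "c dvd content s"
    by (metis content_smult dvd_triv_left normalize_dvd_iff)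
  then obtain t where t: "s = smult c t"
    by (metis const_poly_dvd_iff_dvd_content dvdE mult_smult_left mult.left_neutral smult_one)
  have "smult c q = smult c (p * t)" using eq t by simp
  then have "q = p * t" using s(1) by (simp add: smult_cancel)
  then show ?thesis by simp
qed

text \<open>A common divisor over \<rat> is a scalar multiple of a primitive integer polynomial,
  which by Gauss's lemma already divides \<open>d\<close> and \<open>g\<close> over the
  integers.\<close>

lemma coprime_map_poly_of_int_rat:
  fixes d g :: "int poly"
  assumes "coprime d g" "d \<noteq> 0"
  shows "coprime (map_poly of_int d) (map_poly of_int g :: rat poly)"
proof (rule coprimeI)
  fix r :: "rat poly"
  assume r: "r dvd map_poly of_int d" "r dvd map_poly of_int g"
  have "map_poly of_int d \<noteq> (0 :: rat poly)"
    using assms(2) map_poly_of_int_eq_iff[of d 0] by simp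
  then have "r \<noteq> 0" using r(1) by auto
  then obtain c q where q: "c \<noteq> 0" "content q = 1" "r = smult c (map_poly of_int (q :: int poly))"
    using primitive_multiple by blast
  then have "q dvd d" "q dvd g"
    using r by (auto intro!: primitive_dvd_if_rat_dvd simp: smult_dvd_iff)
  then have "is_unit q" using assms(1) by (meson coprime_common_divisor)
  then have "Polynomial.degree r = 0"
    using q dvd_imp_degree_le[of q 1] by (simp add: degree_map_poly_of_int)
  then show "is_unit r" using \<open>r \<noteq> 0\<close> by (simp add: is_unit_iff_degree)
qed

text \<open>Eisenstein's criterion. Gauss's lemma replaces a rational factorization by an integral
  one of the same degrees, in which \<open>q\<close> would divide both constant
  coefficients.\<close>

lemma irreducible_rat_eisenstein:
  fixes h :: "int poly"
  assumes deg: "Polynomial.degree h > 0" and "Factorial_Ring.prime q"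
    and lc: "Polynomial.lead_coeff h = 1"
    and low: "\<And>i. i < Polynomial.degree h \<Longrightarrow> q dvd poly.coeff h i"
    and sq: "\<not> q\<^sup>2 dvd poly.coeff h 0"
  shows "Factorial_Ring.irreducible (map_poly of_int h :: rat poly)"
proof (rule Factorial_Ring.irreducibleI)
  let ?h = "map_poly of_int h :: rat poly"
  show "?h \<noteq> 0" using deg map_poly_of_int_eq_iff[of h 0] by auto
  show "\<not> is_unit ?h"
    using deg dvd_imp_degree_le[of ?h 1] by (auto simp: degree_map_poly_of_int)
  fix a b :: "rat poly"
  assume ab: "?h = a * b"
  have nz: "a \<noteq> 0" "b \<noteq> 0" using \<open>?h \<noteq> 0\<close> ab by auto
  then obtain c A where A: "c \<noteq> 0" "content A = 1" "a = smult c (map_poly of_int (A :: int poly))"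
    using primitive_multiple by blast
  have "map_poly of_int A dvd ?h"
    using ab A by (simp add: dvd_smult)
  then obtain B where hAB: "h = A * B"
    using primitive_dvd_if_rat_dvd[OF A(2)] by blast
  have h0: "h \<noteq> 0" using deg by auto
  then have AB0: "A \<noteq> 0" "B \<noteq> 0" using hAB by auto
  have degs: "Polynomial.degree h = Polynomial.degree A + Polynomial.degree B"
    using hAB AB0 by (simp add: degree_mult_eq)
  have dega: "Polynomial.degree a = Polynomial.degree A"
    using A by (simp add: degree_map_poly_of_int)
  have degb: "Polynomial.degree b = Polynomial.degree B"
    using degree_map_poly_of_int[of h, where 'a = rat] nz dega degs unfolding ab
    by (simp add: degree_mult_eq)
  have lcu: "Polynomial.lead_coeff A * Polynomial.lead_coeff B = 1"
    using hAB lc by (metis lead_coeff_mult)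
  show "is_unit a \<or> is_unit b"
  proof (rule ccontr)
    assume "\<not> (is_unit a \<or> is_unit b)"
    then have pos: "Polynomial.degree A > 0" "Polynomial.degree B > 0"
      using nz dega degb by (auto simp: is_unit_iff_degree)
    have factor_dvd: "q dvd poly.coeff A 0"
      if "h = A * B" "Polynomial.degree A > 0" "Polynomial.degree B > 0"
        "Polynomial.lead_coeff A * Polynomial.lead_coeff B = 1" for A B :: "int poly"
    proof (rule ccontr)
      assume A0: "\<not> q dvd poly.coeff A 0"
      have "\<not> q dvd Polynomial.lead_coeff B"
        using that(4) \<open>Factorial_Ring.prime q\<close>
        using dvd_mult[of q "lead_coeff B" "lead_coeff A"] not_prime_unit by auto
      \<comment> \<open>With \<open>j\<close> minimal, all summands of coefficient \<open>j\<close>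
        of \<open>A * B\<close> except the one containing \<open>poly.coeff A 0\<close> involve a
        lower coefficient of \<open>B\<close>, hence are divisible by \<open>q\<close>.\<close>
      then obtain j where j: "\<not> q dvd poly.coeff B j" "\<And>i. i < j \<Longrightarrow> q dvd poly.coeff B i"
        using exists_least_iff[of "\<lambda>i. \<not> q dvd poly.coeff B i"] by blast
      have "j \<le> Polynomial.degree B"
        using j(1) by (metis coeff_eq_0 dvd_0_right not_le)
      also have "\<dots> < Polynomial.degree h"
        using that h0 by (auto simp: degree_mult_eq)
      finally have "q dvd poly.coeff h j" by (rule low)
      moreover have "poly.coeff h j =
          poly.coeff A 0 * poly.coeff B j + (\<Sum>i\<in>{1..j}. poly.coeff A i * poly.coeff B (j - i))"
        unfolding that(1) coeff_mult by (simp add: atMost_atLeast0 sum.atLeast_Suc_atMost)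
      moreover have "q dvd (\<Sum>i\<in>{1..j}. poly.coeff A i * poly.coeff B (j - i))"
        using j(2) by (intro dvd_sum) auto
      ultimately have "q dvd poly.coeff A 0 * poly.coeff B j"
        by (simp add: dvd_add_left_iff)
      with A0 j(1) \<open>Factorial_Ring.prime q\<close> show False
        by (simp add: prime_dvd_mult_iff)
    qed
    have "q dvd poly.coeff A 0" "q dvd poly.coeff B 0"
      using factor_dvd[of A B] factor_dvd[of B A] hAB pos lcu by (simp_all add: mult.commute)
    then have "q\<^sup>2 dvd poly.coeff h 0"
      using hAB by (simp add: coeff_mult power2_eq_square mult_dvd_mono)
    with sq show False by simp
  qed
qed

section \<open>Rational polynomials at a complex point\<close>

text \<open>A Bezout identity in \<rat>[x], evaluated at \<open>z\<close>: it excludes common roots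
  and yields inverses in \<rat>[z].\<close>

lemma coprime_rat_eval:
  assumes "coprime r s"
  shows "\<exists>u v. rat_eval z u * rat_eval z r + rat_eval z v * rat_eval z s = 1"
proof -
  obtain u v where "u * r + v * s = 1"
    using assms by (metis bezout_coefficients_fst_snd coprime_iff_gcd_eq_1)
  then have "rat_eval z (u * r + v * s) = 1"
    by (simp add: rat_eval_hom.hom_one)
  then show ?thesis
    by (auto simp: rat_eval_hom.hom_add rat_eval_hom.hom_mult)
qed

lemma irreducible_dvd_if_common_root:
  assumes "Factorial_Ring.irreducible h" "rat_eval z h = 0" "rat_eval z r = 0"
  shows "h dvd r"
proof (rule ccontr)
  assume "\<not> h dvd r"
  then have "coprime h r"
    using assms(1) by (simp add: irreducible_imp_prime_elem prime_elem_imp_coprime)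
  with coprime_rat_eval[of h r z] assms show False by simp
qed

text \<open>At a multiple root the derivative vanishes too, so \<open>h\<close> would divide it; but
  the derivative is nonzero and of smaller degree.\<close>

lemma irreducible_rat_rsquarefree:
  assumes "Factorial_Ring.irreducible h"
  shows "rsquarefree (map_poly of_rat h :: complex poly)"
proof -
  have deg: "Polynomial.degree h > 0"
    using assms is_unit_iff_degree[of h] by (auto simp: Factorial_Ring.irreducible_def)
  have pd: "pderiv (map_poly of_rat h) = (map_poly of_rat (pderiv h) :: complex poly)"
    by (rule poly_eqI) (simp add: coeff_map_poly coeff_pderiv of_rat_mult of_rat_add)
  have "\<not> (rat_eval a h = 0 \<and> rat_eval a (pderiv h) = 0)" for a
  proof
    assume "rat_eval a h = 0 \<and> rat_eval a (pderiv h) = 0"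
    then have "h dvd pderiv h"
      using assms irreducible_dvd_if_common_root by blast
    moreover have "pderiv h \<noteq> 0" using deg by (simp add: pderiv_eq_0_iff)
    ultimately have "Polynomial.degree h \<le> Polynomial.degree (pderiv h)"
      by (rule dvd_imp_degree_le)
    then show False using deg by (simp add: degree_pderiv)
  qed
  then show ?thesis
    unfolding rsquarefree_roots pd rat_eval_def by blast
qed

lemma card_roots_irreducible_rat:
  assumes "Factorial_Ring.irreducible h"
  shows "card {z. rat_eval z h = 0} = Polynomial.degree h"
proof -
  let ?h = "map_poly of_rat h :: complex poly"
  have nz: "?h \<noteq> 0"
    using irreducible_rat_rsquarefree[OF assms] by (simp add: rsquarefree_def)
  have "Polynomial.degree (smult (lead_coeff ?h) (\<Prod>z | poly ?h z = 0. [:-z, 1:])) = Polynomial.degree ?h"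
    using complex_poly_decompose_rsquarefree[OF irreducible_rat_rsquarefree[OF assms]] by simp
  then have "card {z. poly ?h z = 0} = Polynomial.degree ?h"
    using nz by (simp add: degree_prod_eq_sum_degree)
  also have "\<dots> = Polynomial.degree h"
    by (rule degree_map_poly) simp
  finally show ?thesis by (simp add: rat_eval_def)
qed

section \<open>Polynomials over a subfield of the complex numbers\<close>

text \<open>Closure is stated with the arithmetic of the type, so that the record-based notions of
  field and polynomial ring only have to be translated once.\<close>

locale complex_subfield =
  fixes K :: "complex set"
  assumes one_in: "1 \<in> K"
    and uminus_in: "a \<in> K \<Longrightarrow> - a \<in> K"
    and add_in: "a \<in> K \<Longrightarrow> b \<in> K \<Longrightarrow> a + b \<in> K"
    and mult_in: "a \<in> K \<Longrightarrow> b \<in> K \<Longrightarrow> a * b \<in> K"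
    and inverse_in': "a \<in> K \<Longrightarrow> a \<noteq> 0 \<Longrightarrow> inverse a \<in> K"
begin

definition polys :: "complex poly set" where
  "polys = {f. \<forall>i. poly.coeff f i \<in> K}"

lemma zero_in: "0 \<in> K"
  using add_in[OF one_in uminus_in[OF one_in]] by simp

lemma inverse_in: "a \<in> K \<Longrightarrow> inverse a \<in> K"
  using inverse_in' zero_in by (cases "a = 0") auto

lemma diff_in: "a \<in> K \<Longrightarrow> b \<in> K \<Longrightarrow> a - b \<in> K"
  using add_in[of a "- b"] uminus_in by simp

lemma divide_in: "a \<in> K \<Longrightarrow> b \<in> K \<Longrightarrow> a / b \<in> K"
  by (simp add: divide_inverse mult_in inverse_in)

lemma sum_in: "(\<And>i. i \<in> I \<Longrightarrow> f i \<in> K) \<Longrightarrow> (\<Sum>i\<in>I. f i) \<in> K"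
  by (induction I rule: infinite_finite_induct) (auto simp: zero_in add_in)

lemma power_in: "a \<in> K \<Longrightarrow> a ^ n \<in> K"
  by (induction n) (auto simp: one_in mult_in)

lemma of_nat_in: "of_nat n \<in> K"
  by (induction n) (auto simp: zero_in one_in add_in)

lemma of_int_in: "of_int m \<in> K"
  by (cases m rule: int_cases2) (auto simp: of_nat_in uminus_in)

lemma of_rat_in: "of_rat q \<in> K"
  by (cases q) (simp add: of_rat_rat divide_in of_int_in)

lemma rat_eval_in: "z \<in> K \<Longrightarrow> rat_eval z r \<in> K"
  unfolding rat_eval_def poly_altdef
  by (intro sum_in mult_in power_in) (simp_all add: coeff_map_poly of_rat_in)

lemma coeff_in: "f \<in> polys \<Longrightarrow> poly.coeff f i \<in> K"
  by (simp add: polys_def)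

lemma pCons_in_iff: "pCons a f \<in> polys \<longleftrightarrow> a \<in> K \<and> f \<in> polys"
proof
  assume *: "pCons a f \<in> polys"
  show "a \<in> K \<and> f \<in> polys"
    using coeff_in[OF *, of 0] coeff_in[OF *, of "Suc i" for i] by (auto simp: polys_def)
next
  assume "a \<in> K \<and> f \<in> polys"
  then show "pCons a f \<in> polys"
    by (auto simp: polys_def coeff_pCons split: nat.split)
qed

lemma zero_poly_in: "0 \<in> polys"
  by (simp add: polys_def zero_in)

lemma one_poly_in: "1 \<in> polys"
  by (simp add: one_pCons pCons_in_iff zero_poly_in one_in)

lemma diff_poly_in: "f \<in> polys \<Longrightarrow> g \<in> polys \<Longrightarrow> f - g \<in> polys"
  by (simp add: polys_def diff_in)

lemma smult_poly_in: "c \<in> K \<Longrightarrow> f \<in> polys \<Longrightarrow> smult c f \<in> polys"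
  by (simp add: polys_def mult_in)

lemma mult_poly_in: "f \<in> polys \<Longrightarrow> g \<in> polys \<Longrightarrow> f * g \<in> polys"
  by (auto simp: polys_def coeff_mult intro!: sum_in mult_in)

lemma power_poly_in: "f \<in> polys \<Longrightarrow> f ^ n \<in> polys"
  by (induction n) (auto simp: one_poly_in mult_poly_in)

lemma of_rat_poly_in: "map_poly of_rat r \<in> polys"
  by (simp add: polys_def coeff_map_poly of_rat_in)

lemma of_int_poly_in: "map_poly of_int r \<in> polys"
  by (simp add: polys_def coeff_map_poly of_int_in)

text \<open>Long division only subtracts multiples of \<open>g\<close> whose factors are quotients
  of coefficients, so it never leaves K[x].\<close>

lemma div_mod_in:
  assumes "g \<in> polys"
  shows "f \<in> polys \<Longrightarrow> f div g \<in> polys \<and> f mod g \<in> polys"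
proof (induction f)
  case 0
  then show ?case by (simp add: zero_poly_in)
next
  case (pCons a f)
  then have f: "f div g \<in> polys" "f mod g \<in> polys" "pCons a (f mod g) \<in> polys"
    by (auto simp: pCons_in_iff)
  \<comment> \<open>This is the quotient coefficient produced by one step of long division.\<close>
  then have "poly.coeff (pCons a (f mod g)) (Polynomial.degree g) / lead_coeff g \<in> K"
    using assms by (intro divide_in coeff_in)
  with f pCons.prems assms show ?case
    by (auto simp: div_pCons_eq mod_pCons_eq pCons_in_iff zero_poly_in intro!: diff_poly_in smult_poly_in)
qed

lemma poly_ring_over_simps:
  "carrier (poly_ring_over K) = polys"
  "f \<otimes>\<^bsub>poly_ring_over K\<^esub> g = f * g"
  "\<one>\<^bsub>poly_ring_over K\<^esub> = 1"
  "\<zero>\<^bsub>poly_ring_over K\<^esub> = 0"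
  by (simp_all add: poly_ring_over_def ring_of_type_algebra_def polys_def)

lemma inverse_const_poly_in:
  assumes "f \<in> polys" "Polynomial.degree f = 0" "f \<noteq> 0"
  shows "\<exists>g \<in> polys. f * g = 1"
proof -
  obtain a where a: "f = [:a:]"
    using assms(2) by (auto elim: degree_eq_zeroE)
  then show ?thesis
    using assms by (intro bexI[of _ "[:inverse a:]"]) (auto simp: pCons_in_iff zero_poly_in inverse_in one_pCons)
qed

lemma Units_poly_ring_over:
  "Units (poly_ring_over K) = {f \<in> polys. f \<noteq> 0 \<and> Polynomial.degree f = 0}"
proof (intro equalityI subsetI)
  fix f assume "f \<in> Units (poly_ring_over K)"
  then obtain g where g: "f \<in> polys" "f * g = 1"
    by (auto simp: Units_def poly_ring_over_simps)
  then have "f dvd 1" by (metis dvd_triv_left)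
  with g show "f \<in> {f \<in> polys. f \<noteq> 0 \<and> Polynomial.degree f = 0}"
    by (metis (mono_tags, lifting) is_unit_iff_degree mem_Collect_eq mult_zero_left zero_neq_one)
next
  fix f assume f: "f \<in> {f \<in> polys. f \<noteq> 0 \<and> Polynomial.degree f = 0}"
  then obtain g where "g \<in> polys" "f * g = 1"
    using inverse_const_poly_in by blast
  then show "f \<in> Units (poly_ring_over K)"
    using f by (auto simp: Units_def poly_ring_over_simps mult.commute[of _ f])
qed

text \<open>The units of K[x] are the nonzero constants, so divisibility-theoretic irreducibility
  becomes a condition on degrees.\<close>

lemma irreducible_over_iff:
  "irreducible_over K f \<longleftrightarrow> f \<in> polys \<and> Polynomial.degree f > 0 \<and>
    (\<forall>a\<in>polys. \<forall>b\<in>polys. f = a * b \<longrightarrow> Polynomial.degree a = 0 \<or> Polynomial.degree b = 0)"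
    (is "?L \<longleftrightarrow> ?R")
proof
  assume ?L
  then have f: "f \<in> polys" "f \<noteq> 0" "f \<notin> Units (poly_ring_over K)"
    and irr: "\<And>b. b \<in> polys \<Longrightarrow> properfactor (poly_ring_over K) b f \<Longrightarrow> b \<in> Units (poly_ring_over K)"
    by (auto simp: irreducible_over_def ring_irreducible_def Divisibility.irreducible_def poly_ring_over_simps)
  have "Polynomial.degree a = 0 \<or> Polynomial.degree b = 0" if ab: "a \<in> polys" "b \<in> polys" "f = a * b" for a b
  proof (rule ccontr)
    assume deg: "\<not> (Polynomial.degree a = 0 \<or> Polynomial.degree b = 0)"
    then have "a \<notin> Units (poly_ring_over K)"
      by (auto simp: Units_poly_ring_over)
    \<comment> \<open>As \<open>a\<close> is a factor but not a proper one, \<open>f\<close> divides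
      \<open>a\<close>; this would force \<open>b\<close> to be constant.\<close>
    then have "\<not> properfactor (poly_ring_over K) a f" using irr ab by blast
    then obtain c where "a = f * c"
      using ab by (auto simp: properfactor_def factor_def poly_ring_over_simps)
    then have "f dvd a" by simp
    moreover have nz: "a \<noteq> 0" "b \<noteq> 0" using ab f by auto
    ultimately have "Polynomial.degree f \<le> Polynomial.degree a" by (intro dvd_imp_degree_le)
    then show False using deg nz ab(3) by (simp add: degree_mult_eq)
  qed
  with f show ?R by (auto simp: Units_poly_ring_over)
next
  assume R: ?R
  then have f0: "f \<noteq> 0" by auto
  have "b \<in> Units (poly_ring_over K)" if b: "b \<in> polys" "properfactor (poly_ring_over K) b f" for b
  proof -
    obtain c where c: "c \<in> polys" "f = b * c" and nd: "\<And>c. c \<in> polys \<Longrightarrow> b \<noteq> f * c"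
      using b(2) by (auto simp: properfactor_def factor_def poly_ring_over_simps)
    have nz: "b \<noteq> 0" "c \<noteq> 0" using f0 c by auto
    \<comment> \<open>A constant cofactor would be invertible, making \<open>b\<close> a multiple of
      \<open>f\<close> and not a proper factor.\<close>
    have "Polynomial.degree c \<noteq> 0"
    proof
      assume "Polynomial.degree c = 0"
      then obtain c' where "c' \<in> polys" "c * c' = 1"
        using inverse_const_poly_in nz c by blast
      then show False using nd[of c'] c by (simp add: mult.assoc)
    qed
    with R b c nz show ?thesis by (auto simp: Units_poly_ring_over)
  qed
  with R f0 show ?L
    by (auto simp: irreducible_over_def ring_irreducible_def Divisibility.irreducible_def
        poly_ring_over_simps Units_poly_ring_over)
qed

text \<open>Up to a constant, \<open>f\<close> is the minimal polynomial \<open>m\<close> of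
  \<open>x\<close> over \<open>K\<close>: division with remainder shows that \<open>m\<close>
  divides everything in K[x] vanishing at \<open>x\<close>, and irreducibility makes
  \<open>f div m\<close> a unit.\<close>

lemma irreducible_over_dvd_if_common_root:
  assumes irr: "irreducible_over K f" and "poly f x = 0"
    and "g \<in> polys" "poly g x = 0"
  shows "\<exists>c \<in> polys. g = f * c"
proof -
  have f: "f \<in> polys" "Polynomial.degree f > 0"
    using irr by (auto simp: irreducible_over_iff)
  define S where "S = {m \<in> polys. m \<noteq> 0 \<and> poly m x = 0}"
  have "f \<in> S" using assms f by (auto simp: S_def)
  then obtain m where m: "m \<in> S" and min: "\<And>m'. m' \<in> S \<Longrightarrow> Polynomial.degree m \<le> Polynomial.degree m'"
    using arg_min_natI[of "\<lambda>m. m \<in> S" f Polynomial.degree] arg_min_nat_le[of "\<lambda>m. m \<in> S" _ Polynomial.degree]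
    by blast
  have m': "m \<in> polys" "m \<noteq> 0" "poly m x = 0" using m by (auto simp: S_def)
  have *: "k = m * (k div m)" if k: "k \<in> polys" "poly k x = 0" for k
  proof -
    have "poly (k mod m) x = 0"
      using k m' poly_mod[of m x k] by simp
    then have "k mod m \<notin> S \<longrightarrow> k mod m = 0"
      using div_mod_in k m' by (auto simp: S_def)
    moreover have "k mod m \<notin> S" if "k mod m \<noteq> 0"
      using min[of "k mod m"] degree_mod_less[of m k] that m' by auto
    ultimately have "k mod m = 0" by blast
    then show ?thesis by auto
  qed
  have "f div m \<in> polys" using div_mod_in f m' by blast
  moreover have feq: "f = m * (f div m)" using * f assms by blast
  moreover have "Polynomial.degree m \<noteq> 0"
    using m' by (metis degree_eq_zeroE poly_const_conv pCons_0_0)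
  ultimately have "Polynomial.degree (f div m) = 0"
    using irr m' unfolding irreducible_over_iff by metis
  then obtain u where u: "u \<in> polys" "(f div m) * u = 1"
    using inverse_const_poly_in \<open>f div m \<in> polys\<close> feq f(2) by (metis degree_0 less_irrefl mult_zero_right)
  have "f * u = m" using feq u by (metis mult.assoc mult.right_neutral)
  then have "g = f * (u * (g div m))"
    using *[OF assms(3,4)] by (simp flip: mult.assoc)
  moreover have "u * (g div m) \<in> polys"
    using u div_mod_in assms m' by (intro mult_poly_in) auto
  ultimately show ?thesis by blast
qed

end

section \<open>Simple extensions of the rationals\<close>

text \<open>Negation and inversion of the record are given by description, so they are identified
  through their uniqueness in the field.\<close>

lemma ring_of_type_algebra_simps:
  fixes a b :: complex
  shows "\<one>\<^bsub>ring_of_type_algebra\<^esub> = (1 :: complex)"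
    and "\<zero>\<^bsub>ring_of_type_algebra\<^esub> = (0 :: complex)"
    and "a \<oplus>\<^bsub>ring_of_type_algebra\<^esub> b = a + b"
    and "a \<otimes>\<^bsub>ring_of_type_algebra\<^esub> b = a * b"
    and "\<ominus>\<^bsub>ring_of_type_algebra\<^esub> a = - a"
    and "a \<noteq> 0 \<Longrightarrow> inv\<^bsub>ring_of_type_algebra\<^esub> a = inverse a"
proof -
  interpret field "ring_of_type_algebra :: complex ring" by (rule field_from_type_algebra)
  have simps: "\<one>\<^bsub>ring_of_type_algebra\<^esub> = (1 :: complex)"
    "\<zero>\<^bsub>ring_of_type_algebra\<^esub> = (0 :: complex)"
    "a \<oplus>\<^bsub>ring_of_type_algebra\<^esub> b = a + b" "a \<otimes>\<^bsub>ring_of_type_algebra\<^esub> b = a * b"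
    "carrier ring_of_type_algebra = (UNIV :: complex set)" for a b :: complex
    by (simp_all add: ring_of_type_algebra_def)
  show "\<one>\<^bsub>ring_of_type_algebra\<^esub> = (1 :: complex)"
    "\<zero>\<^bsub>ring_of_type_algebra\<^esub> = (0 :: complex)"
    "a \<oplus>\<^bsub>ring_of_type_algebra\<^esub> b = a + b" "a \<otimes>\<^bsub>ring_of_type_algebra\<^esub> b = a * b"
    by (fact simps)+
  show "\<ominus>\<^bsub>ring_of_type_algebra\<^esub> a = - a"
    by (rule minus_equality) (simp_all add: simps)
  show "inv\<^bsub>ring_of_type_algebra\<^esub> a = inverse a" if "a \<noteq> 0"
    by (rule inv_char) (simp_all add: simps that)
qed

lemma complex_subfield_rat_adjoin: "complex_subfield (rat_adjoin z)"
proof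
  show "1 \<in> rat_adjoin z"
    using generate_field.one[of ring_of_type_algebra "{z}"] by (simp add: rat_adjoin_def ring_of_type_algebra_simps)
  fix a b assume a: "a \<in> rat_adjoin z"
  show "- a \<in> rat_adjoin z"
    using a generate_field.a_inv[of a ring_of_type_algebra] by (simp add: rat_adjoin_def ring_of_type_algebra_simps)
  show "inverse a \<in> rat_adjoin z" if "a \<noteq> 0"
    using a that generate_field.m_inv[of a ring_of_type_algebra] by (simp add: rat_adjoin_def ring_of_type_algebra_simps)
  assume b: "b \<in> rat_adjoin z"
  show "a + b \<in> rat_adjoin z"
    using a b generate_field.eng_add[of a ring_of_type_algebra _ b] by (simp add: rat_adjoin_def ring_of_type_algebra_simps)
  show "a * b \<in> rat_adjoin z"
    using a b generate_field.eng_mult[of a ring_of_type_algebra _ b] by (simp add: rat_adjoin_def ring_of_type_algebra_simps)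
qed

lemma self_in_rat_adjoin: "z \<in> rat_adjoin z"
  by (simp add: rat_adjoin_def generate_field.incl)

lemma rat_adjoin_subset:
  assumes "complex_subfield K" "z \<in> K"
  shows "rat_adjoin z \<subseteq> K"
proof
  interpret K: complex_subfield K by fact
  fix a assume "a \<in> rat_adjoin z"
  then show "a \<in> K"
    unfolding rat_adjoin_def
    by (induction rule: generate_field.induct)
      (use assms(2) in \<open>auto simp: ring_of_type_algebra_simps K.one_in K.uminus_in K.add_in K.mult_in K.inverse_in\<close>)
qed

text \<open>Only inversion is not immediate: if \<open>r\<close> does not vanish at
  \<open>z\<close>, it is coprime to \<open>h\<close>, and the Bezout cofactor of \<open>r\<close>
  gives the inverse.\<close>

lemma complex_subfield_range_rat_eval:
  assumes irr: "Factorial_Ring.irreducible h" and "rat_eval z h = 0"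
  shows "complex_subfield (range (rat_eval z))"
proof
  show "1 \<in> range (rat_eval z)"
    by (metis rangeI rat_eval_hom.hom_one)
  fix a b assume "a \<in> range (rat_eval z)"
  then obtain r where r: "a = rat_eval z r" by blast
  show "- a \<in> range (rat_eval z)"
    unfolding r by (metis rangeI rat_eval_hom.hom_uminus)
  show "inverse a \<in> range (rat_eval z)" if "a \<noteq> 0"
  proof -
    have "\<not> h dvd r"
      using that assms by (auto simp: r rat_eval_hom.hom_mult)
    then have "coprime h r"
      using irr by (simp add: irreducible_imp_prime_elem prime_elem_imp_coprime)
    then obtain v where "rat_eval z v * a = 1"
      using coprime_rat_eval[of h r z] assms by (auto simp: r)
    then have "inverse a = rat_eval z v"
      by (metis inverse_unique mult.commute)
    then show ?thesis by simp
  qed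
  assume "b \<in> range (rat_eval z)"
  then obtain s where s: "b = rat_eval z s" by blast
  show "a + b \<in> range (rat_eval z)" "a * b \<in> range (rat_eval z)"
    unfolding r s by (metis rangeI rat_eval_hom.hom_add, metis rangeI rat_eval_hom.hom_mult)
qed

text \<open>Since \<rat>[z] is already a field for algebraic \<open>z\<close>, elements of \<rat>(z)
  can be written as polynomials in \<open>z\<close>.\<close>

lemma rat_adjoin_eq_range_rat_eval:
  assumes "Factorial_Ring.irreducible h" and "rat_eval z h = 0"
  shows "rat_adjoin z = range (rat_eval z)"
proof
  have "z = rat_eval z [:0, 1:]"
    by (simp add: rat_eval_def map_poly_pCons)
  then show "rat_adjoin z \<subseteq> range (rat_eval z)"
    using rat_adjoin_subset[OF complex_subfield_range_rat_eval[OF assms]] by blast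
  show "range (rat_eval z) \<subseteq> rat_adjoin z"
    using complex_subfield.rat_eval_in[OF complex_subfield_rat_adjoin self_in_rat_adjoin] by blast
qed

section \<open>Algebraic elements over a simple extension\<close>

text \<open>The powers of \<open>x\<close> lie in the rational span of the products \<open>z\<^sup>i x\<^sup>j\<close> with
  \<open>i < deg h\<close> and \<open>j < deg f\<close>, so the first \<open>deg h \<cdot> deg f + 1\<close> of them are dependent.\<close>

lemma degree_bound_of_algebraic_over_rat_extension:
  assumes irr: "Factorial_Ring.irreducible h" and root: "rat_eval z h = 0"
    and "f \<in> complex_subfield.polys (rat_adjoin z)" "f \<noteq> 0" "poly f x = 0"
  shows "\<exists>r. r \<noteq> 0 \<and> rat_eval x r = 0 \<and> Polynomial.degree r \<le> Polynomial.degree h * Polynomial.degree f"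
proof (rule ccontr)
  assume "\<not> ?thesis"
  then have none: "r = 0" if "rat_eval x r = 0" "Polynomial.degree r \<le> Polynomial.degree h * Polynomial.degree f" for r
    using that by blast
  interpret K: complex_subfield "rat_adjoin z" by (rule complex_subfield_rat_adjoin)
  interpret Q: vector_space "\<lambda>q y. of_rat q * y :: complex"
    by standard (simp_all add: algebra_simps of_rat_add of_rat_mult)
  let ?n = "Polynomial.degree h" and ?a = "Polynomial.degree f"
  define T where "T = (\<lambda>(i, j). z ^ i * x ^ j) ` ({..<?n} \<times> {..<?a})"
  have h0: "h \<noteq> 0" using irr by auto
  have deg_h: "?n > 0" using irr is_unit_iff_degree[of h] by (auto simp: Factorial_Ring.irreducible_def)
  have deg_f: "?a > 0" using assms(4,5) by (metis degree_eq_zeroE gr0I poly_const_conv pCons_0_0)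
  have "finite T" by (simp add: T_def)
  have span: "x ^ m \<in> Q.span T" for m
  proof -
    \<comment> \<open>Reducing a polynomial expression for \<open>c\<close> modulo \<open>h\<close>
      leaves only powers of \<open>z\<close> below \<open>deg h\<close>.\<close>
    have red: "c * x ^ j \<in> Q.span T" if c: "c \<in> rat_adjoin z" and j: "j < ?a" for c j
    proof -
      obtain r where r: "c = rat_eval z r"
        using c rat_adjoin_eq_range_rat_eval[OF irr root] by blast
      have "rat_eval z (h * (r div h) + r mod h) = rat_eval z (r mod h)"
        using root by (simp only: rat_eval_hom.hom_add rat_eval_hom.hom_mult) simp
      then have "c = rat_eval z (r mod h)" by (simp add: r)
      also have "\<dots> = (\<Sum>i\<le>Polynomial.degree (r mod h). of_rat (poly.coeff (r mod h) i) * z ^ i)"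
        unfolding rat_eval_def poly_altdef by (simp add: coeff_map_poly degree_map_poly)
      finally have "c * x ^ j = (\<Sum>i\<le>Polynomial.degree (r mod h). of_rat (poly.coeff (r mod h) i) * (z ^ i * x ^ j))"
        by (simp add: sum_distrib_right mult.assoc)
      also have "\<dots> \<in> Q.span T"
      proof (intro Q.span_sum Q.span_scale Q.span_base)
        fix i assume "i \<in> {..Polynomial.degree (r mod h)}"
        then have "i < ?n"
          using deg_h degree_mod_less[OF h0, of r] by auto
        then show "z ^ i * x ^ j \<in> T"
          using j by (auto simp: T_def)
      qed
      finally show ?thesis .
    qed
    \<comment> \<open>Likewise the power of \<open>x\<close> is reduced modulo \<open>f\<close>,
      whose remainder has coefficients in \<rat>(z).\<close>
    define u where "u = Polynomial.monom (1 :: complex) m mod f"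
    have "Polynomial.monom (1 :: complex) m \<in> K.polys"
      by (auto simp: K.polys_def K.one_in K.zero_in)
    then have u: "u \<in> K.polys" using K.div_mod_in assms(3) by (simp add: u_def)
    have "x ^ m = poly u x"
      using poly_mod[OF assms(5), of "Polynomial.monom 1 m"] by (simp add: u_def poly_monom)
    also have "\<dots> = (\<Sum>j\<le>Polynomial.degree u. poly.coeff u j * x ^ j)"
      by (rule poly_altdef)
    also have "\<dots> \<in> Q.span T"
    proof (intro Q.span_sum red)
      fix j assume "j \<in> {..Polynomial.degree u}"
      then show "j < ?a"
        using deg_f degree_mod_less[OF assms(4), of "Polynomial.monom 1 m"] by (auto simp: u_def)
    qed (use u K.coeff_in in auto)
    finally show ?thesis .
  qed
  define S where "S = (\<lambda>m. x ^ m) ` {..?n * ?a}"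
  \<comment> \<open>Independence is a property of the set of powers, so coinciding powers must be
    excluded; two of them would give a forbidden polynomial that is a difference of
    monomials.\<close>
  have inj: "inj_on (\<lambda>m. x ^ m) {..?n * ?a}"
  proof (rule inj_onI)
    fix k m assume km: "k \<in> {..?n * ?a}" "m \<in> {..?n * ?a}" "x ^ k = x ^ m"
    have "Polynomial.monom (1 :: rat) k - Polynomial.monom 1 m = 0"
      using km by (intro none)
        (auto simp: rat_eval_def rat_hom.map_poly_hom map_poly_monom poly_monom
          intro!: degree_diff_le order.trans[OF degree_monom_le])
    then show "k = m" by (simp add: monom_eq_iff')
  qed
  have "finite S" by (simp add: S_def)
  have "Q.independent S"
    unfolding Q.dependent_finite[OF \<open>finite S\<close>]
  proof safe
    fix w y assume "y \<in> S" "w y \<noteq> 0" and sum: "(\<Sum>v\<in>S. of_rat (w v) * v) = 0"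
    define r where "r = (\<Sum>m\<le>?n * ?a. Polynomial.monom (w (x ^ m)) m)"
    have "rat_eval x r = (\<Sum>m\<le>?n * ?a. of_rat (w (x ^ m)) * x ^ m)"
      by (simp add: r_def rat_eval_hom.hom_sum) (simp add: rat_eval_def map_poly_monom poly_monom)
    also have "\<dots> = 0"
      using sum unfolding S_def by (simp add: sum.reindex[OF inj])
    finally have "r = 0"
      by (rule none) (auto simp: r_def intro!: degree_sum_le order.trans[OF degree_monom_le])
    obtain m where m: "m \<le> ?n * ?a" "y = x ^ m" using \<open>y \<in> S\<close> by (auto simp: S_def)
    have "poly.coeff r m = w y"
      using m by (simp add: r_def coeff_sum coeff_monom)
    with \<open>r = 0\<close> \<open>w y \<noteq> 0\<close> show False by simp
  qed
  then have "card S \<le> card T"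
    using Q.independent_span_bound[OF \<open>finite T\<close>] span by (auto simp: S_def)
  also have "\<dots> \<le> ?n * ?a"
    unfolding T_def by (rule order.trans[OF card_image_le]) auto
  finally show False by (simp add: S_def card_image[OF inj])
qed

text \<open>Lifted to polynomials over \<open>\<rat>[t]\<close>, the identity \<open>f = q c\<close> holds modulo \<open>h(t)\<close>, hence at every
  root of \<open>h\<close>.\<close>

lemma conjugate_factor:
  fixes q :: "rat poly poly" and f :: "rat poly"
  assumes irr: "Factorial_Ring.irreducible h" and root: "rat_eval z h = 0" "rat_eval y h = 0"
    and c: "c \<in> complex_subfield.polys (rat_adjoin z)"
    and f: "map_poly of_rat f = map_poly (rat_eval z) q * c"
  shows "map_poly (rat_eval y) q dvd map_poly of_rat f"
proof -
  interpret K: complex_subfield "rat_adjoin z" by (rule complex_subfield_rat_adjoin)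
  \<comment> \<open>Each coefficient of \<open>c\<close> is a polynomial in \<open>z\<close>, so
    \<open>c\<close> lifts to a polynomial over \<rat>[t].\<close>
  have "\<exists>C. c = map_poly (rat_eval z) C" using c
  proof (induction c)
    case (pCons a c)
    then obtain C where "c = map_poly (rat_eval z) C" by (auto simp: K.pCons_in_iff)
    moreover have "a \<in> rat_adjoin z" using pCons.prems by (simp add: K.pCons_in_iff)
    then obtain r where "a = rat_eval z r"
      using rat_adjoin_eq_range_rat_eval[OF irr root(1)] by blast
    ultimately have "pCons a c = map_poly (rat_eval z) (pCons r C)"
      by (simp add: map_poly_pCons rat_eval_hom.hom_zero)
    then show ?case by blast
  qed (auto intro: exI[of _ 0])
  then obtain C where C: "c = map_poly (rat_eval z) C" by blast
  have const: "map_poly (rat_eval w) (map_poly (\<lambda>a. [:a:]) f) = map_poly of_rat f" for w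
    by (simp add: map_poly_map_poly o_def rat_eval_def map_poly_pCons)
  define d where "d = map_poly (\<lambda>a. [:a:]) f - q * C"
  have "map_poly (rat_eval z) d = 0"
    by (simp add: d_def rat_eval_hom.map_poly_hom const f C)
  then have "rat_eval z (poly.coeff d i) = 0" for i
    by (metis coeff_0 coeff_map_poly rat_eval_hom.hom_zero)
  then have "h dvd poly.coeff d i" for i
    using irreducible_dvd_if_common_root irr root by blast
  then have "rat_eval y (poly.coeff d i) = 0" for i
    using root(2) by (metis dvdE mult_zero_left rat_eval_hom.hom_mult)
  then have "map_poly (rat_eval y) d = 0"
    by (intro poly_eqI) (simp add: coeff_map_poly rat_eval_hom.hom_zero)
  then have "map_poly of_rat f = map_poly (rat_eval y) q * map_poly (rat_eval y) C"
    by (simp add: d_def rat_eval_hom.map_poly_hom const)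
  then show ?thesis by simp
qed

section \<open>Fibonacci polynomials of odd index\<close>

text \<open>
  For odd index, \<open>F\<^sub>2\<^sub>k\<^sub>+\<^sub>1(x) = half_fib k (x\<^sup>2 + 4)\<close>. The shift by 4 (the discriminant of
  \<open>t\<^sup>2 - x t - 1\<close> is \<open>x\<^sup>2 + 4\<close>) makes Eisenstein's criterion applicable directly.
\<close>

fun half_fib :: "nat \<Rightarrow> int poly" where
  "half_fib 0 = 1"
| "half_fib (Suc 0) = [:-3, 1:]"
| "half_fib (Suc (Suc k)) = [:-2, 1:] * half_fib (Suc k) - half_fib k"

text \<open>Up to sign this is \<open>(2k+1)/(2j+1)\<close> times
  \<open>k + j choose (2 * j)\<close>; the sum of two binomials avoids the fraction and lets
  Pascal's rule match the recurrence.\<close>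

lemma coeff_half_fib:
  "poly.coeff (half_fib k) j = (-1) ^ (k + j) * int ((Suc (k + j) choose (2 * j + 1)) + (k + j choose (2 * j + 1)))"
proof (induction k arbitrary: j rule: half_fib.induct)
  case 1
  show ?case by (cases j) (simp_all add: binomial_eq_0)
next
  case 2
  show ?case
  proof (cases j)
    case (Suc i)
    then show ?thesis by (cases i) (simp_all add: binomial_eq_0 coeff_pCons numeral_3_eq_3)
  qed simp
next
  case (3 k)
  show ?case
  proof (cases j)
    case 0
    then show ?thesis by (simp add: 3 algebra_simps)
  next
    case (Suc i)
    define e :: int where "e = (-1) ^ (k + i)"
    define b where "b m = int (m choose Suc (2 * i))" for m
    define c where "c m = int (m choose Suc (Suc (Suc (2 * i))))" for m
    \<comment> \<open>Iterated Pascal's rule: the second difference of \<open>c\<close> is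
      \<open>b\<close>, just as multiplication by \<open>[:-2, 1:]\<close> requires.\<close>
    have second_difference: "c (Suc (Suc m)) = 2 * c (Suc m) - c m + b m" for m
      by (simp add: b_def c_def)
    have "poly.coeff (half_fib (Suc k)) i = - e * (b (Suc (Suc (k + i))) + b (Suc (k + i)))"
      "poly.coeff (half_fib (Suc k)) j = e * (c (Suc (Suc (Suc (k + i)))) + c (Suc (Suc (k + i))))"
      "poly.coeff (half_fib k) j = - e * (c (Suc (Suc (k + i))) + c (Suc (k + i)))"
      by (simp_all add: 3 Suc e_def b_def c_def del: binomial_Suc_Suc)
    then have "poly.coeff (half_fib (Suc (Suc k))) j =
        - e * (c (Suc (Suc (Suc (Suc (k + i))))) + c (Suc (Suc (Suc (k + i)))))"
      by (simp add: Suc second_difference algebra_simps)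
    also have "\<dots> = (-1) ^ (Suc (Suc k) + j) *
        int ((Suc (Suc (Suc k) + j) choose (2 * j + 1)) + (Suc (Suc k) + j choose (2 * j + 1)))"
      by (simp add: Suc e_def c_def del: binomial_Suc_Suc)
    finally show ?thesis .
  qed
qed

lemma degree_half_fib: "Polynomial.degree (half_fib k) = k"
  and lead_coeff_half_fib: "poly.coeff (half_fib k) k = 1"
proof -
  show c: "poly.coeff (half_fib k) k = 1"
    by (simp add: coeff_half_fib binomial_eq_0 flip: mult_2)
  show "Polynomial.degree (half_fib k) = k"
  proof (rule antisym)
    show "Polynomial.degree (half_fib k) \<le> k"
      by (rule degree_le) (simp add: coeff_half_fib binomial_eq_0)
    show "k \<le> Polynomial.degree (half_fib k)"
      using c by (intro le_degree) simp
  qed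
qed

lemma irreducible_half_fib:
  assumes p: "Factorial_Ring.prime (2 * k + 1)" and "k > 0"
  shows "Factorial_Ring.irreducible (map_poly of_int (half_fib k) :: rat poly)"
proof (rule irreducible_rat_eisenstein)
  show "Factorial_Ring.prime (int (2 * k + 1))" using p by (simp only: prime_nat_int_transfer)
  show "Polynomial.degree (half_fib k) > 0" "lead_coeff (half_fib k) = 1"
    using assms(2) by (simp_all add: degree_half_fib lead_coeff_half_fib)
  have c0: "poly.coeff (half_fib k) 0 = (-1) ^ k * int (2 * k + 1)"
    by (simp add: coeff_half_fib)
  show "\<not> (int (2 * k + 1))\<^sup>2 dvd poly.coeff (half_fib k) 0"
  proof
    assume "(int (2 * k + 1))\<^sup>2 dvd poly.coeff (half_fib k) 0"
    then have "(int (2 * k + 1))\<^sup>2 dvd int (2 * k + 1)"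
      by (metis c0 dvd_mult left_minus_one_mult_self)
    then have "int (2 * k + 1) * int (2 * k + 1) dvd int (2 * k + 1) * 1"
      by (simp add: power2_eq_square)
    then have "int (2 * k + 1) dvd 1"
      by (subst (asm) dvd_mult_cancel_left) auto
    with \<open>k > 0\<close> show False by simp
  qed
  fix j assume "j < Polynomial.degree (half_fib k)"
  then have j: "j < k" by (simp add: degree_half_fib)
  \<comment> \<open>Absorption turns both binomials into multiples of
    \<open>k + j choose (2 * j)\<close>, with factors \<open>k + j + 1\<close> and
    \<open>k - j\<close> that add up to the prime \<open>2 * k + 1\<close>. Writing
    \<open>k = j + t\<close> removes the truncated subtraction.\<close>
  have "(2 * j + 1) * (Suc (k + j) choose (2 * j + 1)) = Suc (k + j) * (k + j choose (2 * j))"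
    using Suc_times_binomial_eq[of "k + j" "2 * j"] by (simp add: mult.commute)
  moreover have "(2 * j + 1) * (k + j choose (2 * j + 1)) = (k - j) * (k + j choose (2 * j))"
    using binomial_absorb_comp[of "k + j" "2 * j"] binomial_absorption[of "2 * j" "k + j"] j by simp
  moreover obtain t where "k = j + t" using j le_Suc_ex less_imp_le by blast
  ultimately have "(2 * j + 1) * ((Suc (k + j) choose (2 * j + 1)) + (k + j choose (2 * j + 1)))
      = (2 * k + 1) * (k + j choose (2 * j))"
    by (simp add: algebra_simps)
  then have "2 * k + 1 dvd (2 * j + 1) * ((Suc (k + j) choose (2 * j + 1)) + (k + j choose (2 * j + 1)))"
    by (metis dvd_triv_left)
  moreover have "\<not> 2 * k + 1 dvd 2 * j + 1" using j by (auto dest: dvd_imp_le)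
  ultimately have "2 * k + 1 dvd (Suc (k + j) choose (2 * j + 1)) + (k + j choose (2 * j + 1))"
    using p by (simp only: prime_dvd_mult_iff) simp
  then show "int (2 * k + 1) dvd poly.coeff (half_fib k) j"
    unfolding coeff_half_fib by (intro dvd_mult) (simp only: int_dvd_int_iff)
qed

text \<open>Passing to every second index gives the recurrence with factor
  \<open>x\<^sup>2 + 2\<close>, which is \<open>t - 2\<close> for
  \<open>t = x\<^sup>2 + 4\<close>.\<close>

lemma poly_fibonacci_odd:
  fixes x :: complex
  shows "poly (map_poly of_int (fibonacci_poly (2 * k + 1))) x = poly (map_poly of_int (half_fib k)) (x\<^sup>2 + 4)"
proof (induction k rule: half_fib.induct)
  case (3 k)
  define f where "f m = poly (map_poly of_int (fibonacci_poly m)) x" for m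
  have rec: "f (Suc (Suc m)) = x * f (Suc m) + f m" for m
    by (simp add: f_def int_hom.map_poly_hom map_poly_pCons)
  have "f (2 * Suc (Suc k) + 1) = (x\<^sup>2 + 2) * f (2 * Suc k + 1) - f (2 * k + 1)"
    by (simp add: rec algebra_simps power2_eq_square)
  also have "\<dots> = poly (map_poly of_int (half_fib (Suc (Suc k)))) (x\<^sup>2 + 4)"
    using 3 by (simp add: f_def int_hom.map_poly_hom map_poly_pCons algebra_simps)
  finally show ?case by (simp only: f_def)
qed (simp_all add: int_hom.map_poly_hom map_poly_pCons numeral_3_eq_3 power2_eq_square algebra_simps)

section \<open>Degrees and values of Fibonacci-type polynomials\<close>

text \<open>As \<open>g\<close> has smaller degree than \<open>d\<close>, the summand with factor
  \<open>d\<close> dominates the recurrence and nothing cancels.\<close>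

lemma degree_fibonacci_type:
  assumes "Polynomial.degree g < Polynomial.degree d"
  shows "fibonacci_type d g (Suc n) \<noteq> 0 \<and> Polynomial.degree (fibonacci_type d g (Suc n)) = n * Polynomial.degree d"
proof (induction n rule: less_induct)
  case (less n)
  show ?case
  proof (cases n)
    case (Suc m)
    let ?f = "fibonacci_type d g"
    have d: "d \<noteq> 0" using assms by auto
    have 1: "?f (Suc m) \<noteq> 0" "Polynomial.degree (?f (Suc m)) = m * Polynomial.degree d"
      using less.IH[of m] Suc by auto
    have 2: "Polynomial.degree (d * ?f (Suc m)) = Suc m * Polynomial.degree d"
      using 1 d by (simp add: degree_mult_eq)
    have "Polynomial.degree (g * ?f m) < Suc m * Polynomial.degree d"
    proof (cases m)
      case 0
      then show ?thesis using assms by simp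
    next
      case (Suc l)
      then have "Polynomial.degree (?f m) = l * Polynomial.degree d"
        using less.IH[of l] \<open>n = Suc m\<close> by auto
      then show ?thesis
        using assms degree_mult_le[of g "?f m"] by (simp add: Suc)
    qed
    then have "Polynomial.degree (?f (Suc n)) = n * Polynomial.degree d"
      using 2 unfolding Suc by (simp add: degree_add_eq_left)
    moreover have "n * Polynomial.degree d > 0" using assms Suc by auto
    ultimately show ?thesis by auto
  qed simp
qed

text \<open>The recurrence is homogeneous when \<open>d\<close> has weight 1 and \<open>g\<close>
  weight 2, so a common scaling factor \<open>s\<close> comes out as a power.\<close>

lemma poly_fibonacci_type:
  fixes x y s :: complex
  assumes "poly (map_poly of_int d) x = y * s" "poly (map_poly of_int g) x = s\<^sup>2"
  shows "poly (map_poly of_int (fibonacci_type d g (Suc n))) x =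
    s ^ n * poly (map_poly of_int (fibonacci_poly (Suc n))) y"
proof (induction n rule: less_induct)
  case (less n)
  consider "n = 0" | "n = 1" | l where "n = Suc (Suc l)"
    by (metis One_nat_def not0_implies_Suc)
  then show ?case
  proof cases
    case 3
    let ?F = "\<lambda>m. poly (map_poly of_int (fibonacci_type d g m)) x"
    let ?f = "\<lambda>m. poly (map_poly of_int (fibonacci_poly m)) y"
    have "?F (Suc n) = y * s * ?F (Suc (Suc l)) + s\<^sup>2 * ?F (Suc l)"
      "?f (Suc n) = y * ?f (Suc (Suc l)) + ?f (Suc l)"
      by (simp_all only: 3 fibonacci_type.simps(3) fibonacci_poly_simps(3) int_hom.map_poly_hom poly_add
          poly_mult assms) (simp add: map_poly_pCons)
    moreover have "?F (Suc l) = s ^ l * ?f (Suc l)" "?F (Suc (Suc l)) = s ^ Suc l * ?f (Suc (Suc l))"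
      using less[of l] less[of "Suc l"] 3 by (simp_all del: fibonacci_type.simps fibonacci_poly_simps)
    ultimately show ?thesis
      by (simp add: 3 algebra_simps power2_eq_square del: fibonacci_type.simps fibonacci_poly_simps)
  qed (simp_all add: int_hom.map_poly_hom map_poly_pCons assms)
qed

section \<open>Coprime complex polynomials and shifted generators\<close>

lemma coprime_complex_poly_if_no_common_root:
  fixes f g :: "complex poly"
  assumes "f \<noteq> 0" "\<And>x. poly f x = 0 \<Longrightarrow> poly g x \<noteq> 0"
  shows "coprime f g"
proof (rule coprimeI)
  fix c assume c: "c dvd f" "c dvd g"
  then have "c \<noteq> 0" using assms(1) by auto
  show "is_unit c"
  proof (rule ccontr)
    assume "\<not> is_unit c"
    then have "Polynomial.degree c > 0"
      using \<open>c \<noteq> 0\<close> by (simp add: is_unit_iff_degree)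
    then obtain x where "poly c x = 0" by (auto dest: alg_closed_imp_poly_has_root)
    then have "poly f x = 0" "poly g x = 0"
      using c by (auto elim!: dvdE)
    then show False using assms(2) by blast
  qed
qed

lemma prod_dvd_if_pairwise_coprime:
  fixes f :: "'a \<Rightarrow> complex poly"
  assumes "finite S" "\<And>s. s \<in> S \<Longrightarrow> f s dvd a"
    and "\<And>s t. s \<in> S \<Longrightarrow> t \<in> S \<Longrightarrow> s \<noteq> t \<Longrightarrow> coprime (f s) (f t)"
  shows "(\<Prod>s\<in>S. f s) dvd a"
  using assms
proof (induction S)
  case (insert s S)
  have "coprime (f s) (\<Prod>s\<in>S. f s)"
    using insert by (intro prod_coprime_right) auto
  with insert show ?case by (auto intro!: divides_mult)
qed simp

lemma rat_adjoin_add_of_int: "rat_adjoin (z + of_int m) = rat_adjoin z"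
proof -
  have "rat_adjoin (w + of_int m) \<subseteq> rat_adjoin w" for w m
    by (intro rat_adjoin_subset complex_subfield_rat_adjoin complex_subfield.add_in
      complex_subfield.of_int_in self_in_rat_adjoin)
  from this[of z m] this[of "z + of_int m" "- m"] show ?thesis by simp
qed

section \<open>Irreducibility of Fibonacci-type polynomials\<close>

locale fibonacci_type_prime =
  fixes d g :: "int poly" and k :: nat
  assumes coprime: "coprime d g"
    and degree_less: "Polynomial.degree g < Polynomial.degree d"
    and prime: "Factorial_Ring.prime (2 * k + 1)" and k_pos: "k > 0"
begin

text \<open>Being monic and irreducible, this is the minimal polynomial of every
  \<open>\<gamma>\<^sup>2 + 4\<close> with \<gamma> a root of the Fibonacci polynomial.\<close>

abbreviation min_poly :: "rat poly" where
  "min_poly \<equiv> map_poly of_int (half_fib k)"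

abbreviation fib :: "rat poly" where
  "fib \<equiv> map_poly of_int (fibonacci_type d g (2 * k + 1))"

text \<open>The factor \<open>d\<^sup>2 - \<gamma>\<^sup>2 g\<close>, in terms of the root \<open>z = \<gamma>\<^sup>2 + 4\<close> of \<open>half_fib k\<close>.\<close>

definition fct :: "complex \<Rightarrow> complex poly" where
  "fct z = (map_poly of_int d)\<^sup>2 - smult (z - 4) (map_poly of_int g)"

lemma irreducible_min_poly: "Factorial_Ring.irreducible min_poly"
  by (rule irreducible_half_fib[OF prime k_pos])

lemma degree_min_poly: "Polynomial.degree min_poly = k"
  by (simp add: degree_map_poly_of_int degree_half_fib)

lemma degree_d_pos: "Polynomial.degree d > 0"
  using degree_less by simp

lemma degree_fib: "fib \<noteq> 0" "Polynomial.degree fib = k * (2 * Polynomial.degree d)"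
  using degree_fibonacci_type[OF degree_less, of "2 * k"] map_poly_of_int_eq_iff[of _ 0, where 'a = rat]
  by (simp_all add: degree_map_poly_of_int)

lemma degree_fct: "Polynomial.degree (fct z) = 2 * Polynomial.degree d"
proof -
  have "Polynomial.degree ((map_poly of_int d :: complex poly)\<^sup>2) = 2 * Polynomial.degree d"
    using degree_d_pos degree_map_poly_of_int[of d, where 'a = complex] by (subst degree_power_eq) auto
  moreover have "Polynomial.degree (smult (z - 4) (map_poly of_int g)) < 2 * Polynomial.degree d"
    using degree_less by (simp add: degree_map_poly_of_int)
  ultimately show ?thesis
    unfolding fct_def diff_conv_add_uminus by (subst degree_add_eq_left) simp_all
qed

lemma no_common_root:
  "\<not> (poly (map_poly of_int d) x = 0 \<and> poly (map_poly of_int g) (x :: complex) = 0)"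
proof -
  have "coprime (map_poly of_int d) (map_poly of_int g :: rat poly)"
    using coprime degree_d_pos by (intro coprime_map_poly_of_int_rat) auto
  from coprime_rat_eval[OF this, of x] show ?thesis
    by (auto simp: rat_eval_of_int)
qed

text \<open>At a common root the difference of the two polynomials makes \<open>g\<close> vanish,
  and then \<open>d\<close> vanishes as well.\<close>

lemma coprime_fct:
  assumes "y \<noteq> z"
  shows "coprime (fct y) (fct z)"
proof (rule coprime_complex_poly_if_no_common_root)
  show "fct y \<noteq> 0" using degree_fct[of y] degree_d_pos by auto
  show "poly (fct z) x \<noteq> 0" if "poly (fct y) x = 0" for x
  proof
    assume "poly (fct z) x = 0"
    with that have "(y - 4) * poly (map_poly of_int g) x = (z - 4) * poly (map_poly of_int g) x"
      by (simp add: fct_def)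
    then have "poly (map_poly of_int g) x = 0" using assms by simp
    with that no_common_root[of x] show False by (simp add: fct_def)
  qed
qed

text \<open>At \<open>x\<close> the values satisfy \<open>d\<^sup>2 = (z - 4) g\<close>; with square
  roots \<open>y\<close> of \<open>z - 4\<close> and \<open>t\<close> of \<open>g\<close>, the
  Fibonacci-type value is a power of \<open>t\<close> times the Fibonacci value at \<open>y\<close>,
  which is 0.\<close>

lemma fib_root_if_fct_root:
  assumes z: "rat_eval z min_poly = 0" and x: "poly (fct z) x = 0"
  shows "rat_eval x fib = 0"
proof -
  define y where "y = csqrt (z - 4)"
  have y: "y\<^sup>2 = z - 4" by (simp add: y_def)
  define s where "s = csqrt (poly (map_poly of_int g) x)"
  have s: "poly (map_poly of_int g) x = s\<^sup>2" by (simp add: s_def)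
  have "(poly (map_poly of_int d) x)\<^sup>2 = (y * s)\<^sup>2"
    using x by (simp add: fct_def y s power_mult_distrib)
  \<comment> \<open>The chosen root \<open>s\<close> may have the wrong sign; replacing it by its
    negative keeps its square.\<close>
  then have "poly (map_poly of_int d) x = y * s \<or> poly (map_poly of_int d) x = y * (- s)"
    by (simp add: power2_eq_iff)
  then obtain t where "poly (map_poly of_int d) x = y * t" "poly (map_poly of_int g) x = t\<^sup>2"
    using s by (metis power2_minus)
  then have "poly (map_poly of_int (fibonacci_type d g (2 * k + 1))) x =
      t ^ (2 * k) * poly (map_poly of_int (fibonacci_poly (2 * k + 1))) y"
    using poly_fibonacci_type[of d x y t g "2 * k"] by simp
  also have "\<dots> = 0"
    using z unfolding poly_fibonacci_odd y by (simp add: rat_eval_of_int)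
  finally show ?thesis by (simp only: rat_eval_of_int)
qed

lemma degree_ge_if_root:
  assumes z: "rat_eval z min_poly = 0" and irr: "irreducible_over (rat_adjoin z) (fct z)"
    and x: "poly (fct z) x = 0" and r: "r \<noteq> 0" "rat_eval x r = 0"
  shows "Polynomial.degree fib \<le> Polynomial.degree r"
proof -
  interpret K: complex_subfield "rat_adjoin z" by (rule complex_subfield_rat_adjoin)
  obtain c where c: "c \<in> K.polys" "map_poly of_rat r = fct z * c"
    using K.irreducible_over_dvd_if_common_root[OF irr x K.of_rat_poly_in, of r] r(2)
    by (auto simp: rat_eval_def)
  \<comment> \<open>The generic factor: the coefficient variable t stands for \<open>z\<close>, and
    \<open>[:-4, 1:]\<close> for \<open>z - 4\<close>, so specialising t gives all conjugates at
    once.\<close>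
  define q :: "rat poly poly" where
    "q = (map_poly of_int d)\<^sup>2 - smult [:-4, 1:] (map_poly of_int g)"
  have eval_of_int: "rat_eval y (of_int a) = of_int a" for y a
    by (simp add: rat_eval_def of_int_poly map_poly_pCons)
  have q: "map_poly (rat_eval y) q = fct y" for y
    by (simp add: q_def fct_def rat_eval_hom.map_poly_hom map_poly_map_poly o_def
        eval_of_int rat_eval_hom.hom_zero) (simp add: rat_eval_def map_poly_pCons)
  let ?S = "{y. rat_eval y min_poly = 0}"
  have card: "card ?S = k"
    using card_roots_irreducible_rat[OF irreducible_min_poly] degree_min_poly by simp
  then have "finite ?S" using k_pos by (metis card.infinite less_irrefl)
  then have "(\<Prod>y\<in>?S. fct y) dvd map_poly of_rat r"
    using conjugate_factor[OF irreducible_min_poly z _ c(1), of _ r q] c(2) q coprime_fct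
    by (intro prod_dvd_if_pairwise_coprime) auto
  then have "Polynomial.degree (\<Prod>y\<in>?S. fct y) \<le> Polynomial.degree (map_poly of_rat r :: complex poly)"
    using r(1) by (intro dvd_imp_degree_le) (auto simp: map_poly_eq_0_iff)
  moreover have "fct y \<noteq> 0" for y
    using degree_fct[of y] degree_d_pos by auto
  ultimately show ?thesis
    unfolding degree_fib(2) by (simp add: degree_prod_eq_sum_degree degree_fct card degree_map_poly)
qed

text \<open>One of two factors vanishes at a root of \<open>fct z\<close>, so by the degree bound it
  has full degree and the other is constant.\<close>

lemma irreducible_fib_if_irreducible_fct:
  assumes z: "rat_eval z min_poly = 0" and irr: "irreducible_over (rat_adjoin z) (fct z)"
  shows "Factorial_Ring.irreducible fib"
proof (rule Factorial_Ring.irreducibleI)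
  show "fib \<noteq> 0" by (rule degree_fib)
  show "\<not> is_unit fib"
    using degree_fib degree_d_pos k_pos is_unit_iff_degree[of fib] by simp
  fix a b assume ab: "fib = a * b"
  then have nz: "a \<noteq> 0" "b \<noteq> 0" using degree_fib(1) by auto
  have deg: "Polynomial.degree fib = Polynomial.degree a + Polynomial.degree b"
    unfolding ab using nz by (rule degree_mult_eq)
  obtain x where x: "poly (fct z) x = 0"
    using alg_closed_imp_poly_has_root[of "fct z"] degree_fct degree_d_pos by auto
  have "rat_eval x (a * b) = 0"
    using fib_root_if_fct_root[OF z x] by (simp only: ab)
  then have "rat_eval x a = 0 \<or> rat_eval x b = 0"
    by (simp add: rat_eval_hom.hom_mult)
  then have "Polynomial.degree a = 0 \<or> Polynomial.degree b = 0"
    using degree_ge_if_root[OF z irr x] nz deg by fastforce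
  then show "is_unit a \<or> is_unit b"
    using nz by (simp add: is_unit_iff_degree)
qed

lemma irreducible_fct_if_irreducible_fib:
  assumes irr: "Factorial_Ring.irreducible fib" and z: "rat_eval z min_poly = 0"
  shows "irreducible_over (rat_adjoin z) (fct z)"
proof -
  interpret K: complex_subfield "rat_adjoin z" by (rule complex_subfield_rat_adjoin)
  have "z - 4 \<in> rat_adjoin z"
    using K.diff_in[OF self_in_rat_adjoin K.of_int_in[of 4]] by simp
  then have "fct z \<in> K.polys"
    unfolding fct_def by (intro K.diff_poly_in K.power_poly_in K.smult_poly_in K.of_int_poly_in)
  moreover have "Polynomial.degree a = 0 \<or> Polynomial.degree b = 0"
    if ab: "a \<in> K.polys" "b \<in> K.polys" "fct z = a * b" for a b
  proof (rule ccontr)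
    assume deg: "\<not> (Polynomial.degree a = 0 \<or> Polynomial.degree b = 0)"
    then have nz: "a \<noteq> 0" "b \<noteq> 0" by auto
    obtain x where x: "poly a x = 0"
      using alg_closed_imp_poly_has_root[of a] deg by auto
    then have "rat_eval x fib = 0"
      using fib_root_if_fct_root[OF z] ab(3) by simp
    moreover obtain r where r: "r \<noteq> 0" "rat_eval x r = 0" "Polynomial.degree r \<le> k * Polynomial.degree a"
      using degree_bound_of_algebraic_over_rat_extension[OF irreducible_min_poly z ab(1) nz(1) x]
      by (auto simp: degree_min_poly)
    \<comment> \<open>Irreducibility makes \<open>fib\<close> divide \<open>r\<close>, so the factor
      \<open>a\<close> must already have the full degree of \<open>fct z\<close>.\<close>
    ultimately have "Polynomial.degree fib \<le> Polynomial.degree r"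
      using irr by (intro dvd_imp_degree_le irreducible_dvd_if_common_root)
    then have "k * (2 * Polynomial.degree d) \<le> k * Polynomial.degree a"
      unfolding degree_fib(2) using r(3) by (rule order.trans)
    then have "2 * Polynomial.degree d \<le> Polynomial.degree a"
      using k_pos by simp
    moreover have "2 * Polynomial.degree d = Polynomial.degree a + Polynomial.degree b"
      using degree_fct[of z] nz by (simp add: ab(3) degree_mult_eq)
    ultimately show False using deg by simp
  qed
  ultimately show ?thesis
    unfolding K.irreducible_over_iff using degree_d_pos by (auto simp: degree_fct)
qed

end

theorem theorem3p8:
  fixes d g :: "int poly" and p :: nat
  assumes "d \<noteq> 0" and "g \<noteq> 0"
    and "coprime d g"
    and "Polynomial.degree g < Polynomial.degree d"
    and "Factorial_Ring.prime p" and "p > 2"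
  shows "Factorial_Ring.irreducible (map_poly of_int (fibonacci_type d g p) :: rat poly) \<longleftrightarrow>
    (\<exists>\<gamma> \<in> {z :: complex. poly (map_poly of_int (fibonacci_poly p)) z = 0}.
       irreducible_over (rat_adjoin (\<gamma>\<^sup>2))
         ((map_poly of_int d)\<^sup>2 - smult (\<gamma>\<^sup>2) (map_poly of_int g)))"
proof -
  have "odd p" using assms by (simp add: prime_odd_nat)
  then obtain k where p: "p = 2 * k + 1" by (auto elim: oddE)
  interpret fibonacci_type_prime d g k
    using assms by unfold_locales (simp_all add: p)
  have root: "poly (map_poly of_int (fibonacci_poly p)) \<gamma> = 0 \<longleftrightarrow> rat_eval (\<gamma>\<^sup>2 + 4) min_poly = 0"
    for \<gamma> :: complex
    unfolding p poly_fibonacci_odd rat_eval_of_int ..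
  have adjoin: "rat_adjoin (\<gamma>\<^sup>2) = rat_adjoin (\<gamma>\<^sup>2 + 4)" for \<gamma>
    using rat_adjoin_add_of_int[of "\<gamma>\<^sup>2" 4] by simp
  have fct: "(map_poly of_int d)\<^sup>2 - smult (\<gamma>\<^sup>2) (map_poly of_int g) = fct (\<gamma>\<^sup>2 + 4)" for \<gamma>
    by (simp add: fct_def)
  \<comment> \<open>The forward direction needs some \<gamma>: any complex root \<open>z\<close> of
    \<open>min_poly\<close> provides \<open>csqrt (z - 4)\<close>.\<close>
  have "Polynomial.degree (map_poly of_rat min_poly :: complex poly) > 0"
    using k_pos degree_min_poly by (simp add: degree_map_poly)
  then obtain z where "rat_eval z min_poly = 0"
    unfolding rat_eval_def using alg_closed_imp_poly_has_root by blast
  then have z: "rat_eval ((csqrt (z - 4))\<^sup>2 + 4) min_poly = 0" by simp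
  show ?thesis
    unfolding adjoin fct
  proof
    assume "Factorial_Ring.irreducible (map_poly of_int (fibonacci_type d g p) :: rat poly)"
    then have "irreducible_over (rat_adjoin ((csqrt (z - 4))\<^sup>2 + 4)) (fct ((csqrt (z - 4))\<^sup>2 + 4))"
      unfolding p using z by (rule irreducible_fct_if_irreducible_fib)
    then show "\<exists>\<gamma>\<in>{z. poly (map_poly of_int (fibonacci_poly p)) z = 0}.
        irreducible_over (rat_adjoin (\<gamma>\<^sup>2 + 4)) (fct (\<gamma>\<^sup>2 + 4))"
      using z root by blast
  next
    assume "\<exists>\<gamma>\<in>{z. poly (map_poly of_int (fibonacci_poly p)) z = 0}.
        irreducible_over (rat_adjoin (\<gamma>\<^sup>2 + 4)) (fct (\<gamma>\<^sup>2 + 4))"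
    then obtain \<gamma> where "rat_eval (\<gamma>\<^sup>2 + 4) min_poly = 0"
      "irreducible_over (rat_adjoin (\<gamma>\<^sup>2 + 4)) (fct (\<gamma>\<^sup>2 + 4))"
      using root by blast
    then show "Factorial_Ring.irreducible (map_poly of_int (fibonacci_type d g p) :: rat poly)"
      unfolding p by (rule irreducible_fib_if_irreducible_fct)
  qed
qed

end
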